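(* Let $d\in\mathbb{N}$, $A\in M_d$ and $\theta\in\mathbb{R}$. Then: (i) The maximal eigenvalue of the compression $A'(\theta)|_{X_{\mathrm m}(\theta)}$ is $\lambda_{\mathrm m}'(\theta;1)$, and the minimal eigenvalue of $A'(\theta)|_{X_{\mathrm m}(\theta)}$ is $-\lambda_{\mathrm m}'(\theta;-1)$. (ii) For all unit vectors $x\in X_{\mathrm m}(\theta)$ we have $f_{A'(\theta)|_{X_{\mathrm m}(\theta)}}(x)=g_\theta(f_A(x))$. (iii) The restriction $g_\theta|_{F_A(\theta)}$ is a bijection from $F_A(\theta)$ onto the segment $s\subset\mathbb{R}$ with endpoints $\lambda_{\mathrm m}'(\theta;1)$ and $-\lambda_{\mathrm m}'(\theta;-1)$, and its inverse is $h_\theta|_s$.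
   Context: $M_d$ is the set of complex $d\times d$ matrices. On $\mathbb{C}\cong\mathbb{R}^2$ use the scalar product $\langle\alpha,\beta\rangle=\Re(\alpha\overline{\beta})$. For $B\in M_d$, $f_B(x)=x^*Bx$ for unit vectors $x\in\mathbb{C}^d$, and $W(B)=\{f_B(x)\mid x\in\mathbb{C}^d,\ x^*x=1\}$ is the numerical range. For $B\in M_d$ and a subspace $X\subset\mathbb{C}^d$ with orthogonal projection $P$ onto $X$, the compression $B|_X$ is the restriction of $PBP$ to $X$, and $f_{B|_X}(x)=x^*(B|_X)x$ for unit vectors $x\in X$. Put $\Re(B)=\tfrac12(B+B^* )$, $\Im(B)=\tfrac1{2\mathrm{i}}(B-B^* )$. For $A\in M_d$ and $\theta\in\mathbb{R}$: $A(\theta)=\Re(e^{-\mathrm{i}\theta}A)=\cos(\theta)\Re(A)+\sin(\theta)\Im(A)$; $A'(\theta)=\Im(e^{-\mathrm{i}\theta}A)$ is its derivative with respect to $\theta$; $\lambda_{\mathrm m}(\theta)$ is the maximal eigenvalue of $A(\theta)$; $X_{\mathrm m}(\theta)$ is the corresponding eigenspace of $A(\theta)$; $\lambda_{\mathrm m}'(\theta;v)=\lim_{t\to0^+}\tfrac1t(\lambda_{\mathrm m}(\theta+tv)-\lambda_{\mathrm m}(\theta))$ is the directional derivative for $v=\pm1$ (it exists); $F_A(\theta)=\operatorname{argmax}_{\alpha\in W(A)}\langle\alpha,e^{\mathrm{i}\theta}\rangle$ is the exposed face of $W(A)$ with outward normal vector $e^{\mathrm{i}\theta}$ (a segment, possibly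 a single point). Define $g_\theta:\mathbb{C}\to\mathbb{R}$, $\alpha\mapsto\langle\alpha,\mathrm{i}e^{\mathrm{i}\theta}\rangle$, and $h_\theta:\mathbb{R}\to\mathbb{C}$, $\eta\mapsto e^{\mathrm{i}\theta}(\lambda_{\mathrm m}(\theta)+\mathrm{i}\eta)$. Segments may be degenerate. *)

theory Defs
  imports "HOL-Analysis.Analysis"
begin

(* x^* y, conjugate-linear in the first argument; the inner product of the library on
   complex^'n is only its real part. *)
definition cinner :: "complex ^ 'n \<Rightarrow> complex ^ 'n \<Rightarrow> complex" where
  "cinner x y = (\<Sum>i\<in>UNIV. cnj (x $ i) * y $ i)"

definition cadjoint :: "complex ^ 'n ^ 'n \<Rightarrow> complex ^ 'n ^ 'n" where
  "cadjoint B = (\<chi> i j. cnj (B $ j $ i))"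

definition mat_Re :: "complex ^ 'n ^ 'n \<Rightarrow> complex ^ 'n ^ 'n" where
  "mat_Re B = map_matrix ((*) (1 / 2)) (B + cadjoint B)"

definition mat_Im :: "complex ^ 'n ^ 'n \<Rightarrow> complex ^ 'n ^ 'n" where
  "mat_Im B = map_matrix ((*) (1 / (2 * \<i>))) (B - cadjoint B)"

definition A_of :: "complex ^ 'n ^ 'n \<Rightarrow> real \<Rightarrow> complex ^ 'n ^ 'n" where
  "A_of A \<theta> = mat_Re (map_matrix ((*) (cis (- \<theta>))) A)"

definition A'_of :: "complex ^ 'n ^ 'n \<Rightarrow> real \<Rightarrow> complex ^ 'n ^ 'n" where
  "A'_of A \<theta> = mat_Im (map_matrix ((*) (cis (- \<theta>))) A)"

(* A matrix acts as an operator on UNIV, a compression as an operator on a subspace X;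
   the next notions take the operator as a function so that they serve both. *)

definition eigenvalue_on ::
    "(complex ^ 'n) set \<Rightarrow> (complex ^ 'n \<Rightarrow> complex ^ 'n) \<Rightarrow> complex \<Rightarrow> bool" where
  "eigenvalue_on X T \<mu> \<longleftrightarrow> (\<exists>x\<in>X. x \<noteq> 0 \<and> T x = \<mu> *s x)"

(* Speaking of a maximal or minimal eigenvalue includes that all eigenvalues are real. *)

definition is_max_eigenvalue_on ::
    "(complex ^ 'n) set \<Rightarrow> (complex ^ 'n \<Rightarrow> complex ^ 'n) \<Rightarrow> real \<Rightarrow> bool" where
  "is_max_eigenvalue_on X T r \<longleftrightarrow>
     eigenvalue_on X T (complex_of_real r) \<and>
     (\<forall>\<mu>. eigenvalue_on X T \<mu> \<longrightarrow> \<mu> \<in> \<real> \<and> Re \<mu> \<le> r)"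

definition is_min_eigenvalue_on ::
    "(complex ^ 'n) set \<Rightarrow> (complex ^ 'n \<Rightarrow> complex ^ 'n) \<Rightarrow> real \<Rightarrow> bool" where
  "is_min_eigenvalue_on X T r \<longleftrightarrow>
     eigenvalue_on X T (complex_of_real r) \<and>
     (\<forall>\<mu>. eigenvalue_on X T \<mu> \<longrightarrow> \<mu> \<in> \<real> \<and> r \<le> Re \<mu>)"

definition num_form :: "(complex ^ 'n \<Rightarrow> complex ^ 'n) \<Rightarrow> complex ^ 'n \<Rightarrow> complex" where
  "num_form T x = cinner x (T x)"

definition numerical_range :: "complex ^ 'n ^ 'n \<Rightarrow> complex set" where
  "numerical_range B = {num_form ((*v) B) x | x. cinner x x = 1}"

definition orth_proj :: "(complex ^ 'n) set \<Rightarrow> complex ^ 'n \<Rightarrow> complex ^ 'n" where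
  "orth_proj X v = (THE w. w \<in> X \<and> (\<forall>u\<in>X. cinner u (v - w) = 0))"

definition compression ::
    "complex ^ 'n ^ 'n \<Rightarrow> (complex ^ 'n) set \<Rightarrow> complex ^ 'n \<Rightarrow> complex ^ 'n" where
  "compression B X = restrict (\<lambda>x. orth_proj X (B *v orth_proj X x)) X"

definition lam_max :: "complex ^ 'n ^ 'n \<Rightarrow> real \<Rightarrow> real" where
  "lam_max A \<theta> = (THE r. is_max_eigenvalue_on UNIV ((*v) (A_of A \<theta>)) r)"

definition X_max :: "complex ^ 'n ^ 'n \<Rightarrow> real \<Rightarrow> (complex ^ 'n) set" where
  "X_max A \<theta> = {x. A_of A \<theta> *v x = complex_of_real (lam_max A \<theta>) *s x}"

definition dir_deriv :: "(real \<Rightarrow> real) \<Rightarrow> real \<Rightarrow> real \<Rightarrow> real" where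
  "dir_deriv f \<theta> v = Lim (at_right 0) (\<lambda>t. (f (\<theta> + t * v) - f \<theta>) / t)"

lemma inner_complex_eq_Re_mult_cnj: "inner \<alpha> \<beta> = Re (\<alpha> * cnj \<beta>)"
  by (simp add: inner_complex_def)

definition exposed_face :: "complex ^ 'n ^ 'n \<Rightarrow> real \<Rightarrow> complex set" where
  "exposed_face A \<theta> =
     {\<alpha>. is_arg_max (\<lambda>\<alpha>. inner \<alpha> (cis \<theta>)) (\<lambda>\<alpha>. \<alpha> \<in> numerical_range A) \<alpha>}"

definition g_map :: "real \<Rightarrow> complex \<Rightarrow> real" where
  "g_map \<theta> \<alpha> = inner \<alpha> (\<i> * cis \<theta>)"

definition h_map :: "complex ^ 'n ^ 'n \<Rightarrow> real \<Rightarrow> real \<Rightarrow> complex" where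
  "h_map A \<theta> \<eta> =
     cis \<theta> * (complex_of_real (lam_max A \<theta>) + \<i> * complex_of_real \<eta>)"

end

theory Submission
  imports Defs
begin

text \<open>
  For a unit vector \<open>x\<close>, both Hermitian matrices \<open>A(\<theta>)\<close> and \<open>A'(\<theta>)\<close> read off a coordinate of
  the point \<open>f\<^sub>A(x)\<close> of the numerical range in the orthonormal frame
  \<open>cis \<theta>, \<i> * cis \<theta>\<close> of the plane: \<open>x\<^sup>* A(\<theta>) x\<close> is the coordinate along the normal, and
  \<open>x\<^sup>* A'(\<theta>) x = g\<^sub>\<theta>(f\<^sub>A(x))\<close> the one along the tangent (\<open>num_form_A_of\<close>, \<open>num_form_A'_of\<close>).
  A compression to \<open>X\<close> has the same quadratic form on \<open>X\<close>, which gives (ii).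

  By the Rayleigh principle, \<open>\<lambda>\<^sub>m\<close> is the support function of the compact set \<open>W(A)\<close>, evaluated at
  \<open>cis \<theta>\<close>, and the unit vectors at which the maximum is attained are those of \<open>X\<^sub>m(\<theta>)\<close>. So
  \<open>F\<^sub>A(\<theta>)\<close> is the image of the unit sphere of \<open>X\<^sub>m(\<theta>)\<close> under \<open>f\<^sub>A\<close> (\<open>exposed_face_eq\<close>). A maximum of
  smooth functions over a compact set has directional derivatives, and they are the maxima of the
  derivatives over the active functions (Danskin); for a support function this is
  \<open>support_function_directional_derivative\<close>. Since the derivative of \<open>cis\<close> at \<open>\<theta>\<close> is \<open>\<i> * cis \<theta>\<close>,
  the derivative of \<open>\<lambda>\<^sub>m\<close> in direction \<open>v\<close> is the maximum of \<open>v * g\<^sub>\<theta>\<close> over \<open>F\<^sub>A(\<theta>)\<close>. For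
  \<open>v = 1\<close> and \<open>v = -1\<close> this identifies the two derivatives with the maximum and the negated minimum
  of the form of \<open>A'(\<theta>)\<close> over the unit sphere of \<open>X\<^sub>m(\<theta>)\<close>. These extreme values are the extreme
  eigenvalues of the compression, again by the Rayleigh principle, and (i) follows.

  For (iii), all points of \<open>F\<^sub>A(\<theta>)\<close> have the same normal coordinate \<open>\<lambda>\<^sub>m(\<theta>)\<close>, so the tangential
  coordinate determines them, by the formula for \<open>h\<^sub>\<theta>\<close>. It remains to see that every value between
  the two extremes is attained: extremal vectors for different extreme
  values are orthogonal and do not interact under the form, so rotating one into the other runs
  through the segment (\<open>symmetric_form_fills_segment\<close>).
\<close>

section \<open>Symmetric forms on a subspace\<close>

text \<open>
  The form \<open>\<lambda>z. r * inner z z - inner z (M z)\<close> is nonnegative on \<open>S\<close> and vanishes at \<open>x\<close>, so along each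
  line \<open>x + t y\<close> in \<open>S\<close> it is minimal at \<open>t = 0\<close>, and its derivative there vanishes. That
  \<open>M x - r *\<^sub>R x\<close> is orthogonal to \<open>S\<close> is the eigenvalue equation of the compression of \<open>M\<close> to
  \<open>S\<close>, expressed without a projection.
\<close>

lemma symmetric_form_maximizer:
  fixes M :: "'a::real_inner \<Rightarrow> 'a"
  assumes lin: "linear M" and sym: "\<And>x y. inner x (M y) = inner (M x) y"
    and S: "subspace S" "x \<in> S" "y \<in> S"
    and le: "\<And>z. z \<in> S \<Longrightarrow> inner z (M z) \<le> r * inner z z"
    and eq: "inner x (M x) = r * inner x x"
  shows "inner y (M x - r *\<^sub>R x) = 0"
proof -
  define k where "k = r * inner x y - inner y (M x)"
  define c where "c = r * inner y y - inner y (M y)"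
  have "c \<ge> 0" unfolding c_def using le[of y] S by simp
  have quad: "0 \<le> 2 * t * k + t\<^sup>2 * c" for t
  proof -
    let ?z = "x + t *\<^sub>R y"
    have "?z \<in> S" using S by (simp add: subspace_add subspace_scale)
    then have "0 \<le> r * inner ?z ?z - inner ?z (M ?z)" using le by simp
    also have "\<dots> = 2 * t * k + t\<^sup>2 * c"
      using eq sym[of x y]
      by (simp add: linear_add[OF lin] linear_scale[OF lin] inner_add_left inner_add_right
          inner_commute[of y x] inner_commute[of "M x" y] k_def c_def algebra_simps power2_eq_square)
    finally show ?thesis .
  qed
  \<comment> \<open>The vertex of the parabola is at \<open>- k / c\<close>; using \<open>c + 1\<close> avoids the case \<open>c = 0\<close>.\<close>
  have "2 * (- k / (c + 1)) * k + (- k / (c + 1))\<^sup>2 * c = - (k\<^sup>2 * (c + 2)) / (c + 1)\<^sup>2"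
    using \<open>c \<ge> 0\<close> by (simp add: divide_simps) (simp add: algebra_simps power2_eq_square)
  then have "k\<^sup>2 * (c + 2) \<le> 0"
    using quad[of "- k / (c + 1)"] \<open>c \<ge> 0\<close> by (simp add: divide_le_0_iff zero_le_divide_iff)
  then have "k = 0"
    using \<open>c \<ge> 0\<close> by (smt (verit) mult_pos_pos zero_less_power2)
  then show ?thesis
    by (simp add: k_def inner_diff_right inner_commute)
qed

lemma unit_bound_imp_form_bound:
  fixes M :: "'a::real_inner \<Rightarrow> 'a"
  assumes "linear M" "subspace S" "z \<in> S"
    and "\<And>x. x \<in> S \<Longrightarrow> norm x = 1 \<Longrightarrow> inner x (M x) \<le> r"
  shows "inner z (M z) \<le> r * inner z z"
proof (cases "z = 0")
  case False
  let ?x = "(1 / norm z) *\<^sub>R z"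
  have "inner ?x (M ?x) \<le> r"
    using assms False by (intro assms(4)) (simp_all add: subspace_scale)
  then have "inner z (M z) / (norm z)\<^sup>2 \<le> r"
    using assms(1) by (simp add: linear_scale power2_eq_square)
  then show ?thesis
    using False by (simp add: dot_square_norm divide_le_eq)
qed (use linear_0[OF assms(1)] in simp)

lemma form_max_orthogonal_residual:
  fixes M :: "'a::real_inner \<Rightarrow> 'a"
  assumes lin: "linear M" and sym: "\<And>x y. inner x (M y) = inner (M x) y"
    and S: "subspace S" and x: "x \<in> S" "norm x = 1" and y: "y \<in> S"
    and max: "\<And>z. z \<in> S \<Longrightarrow> norm z = 1 \<Longrightarrow> inner z (M z) \<le> inner x (M x)"
  shows "inner y (M x - inner x (M x) *\<^sub>R x) = 0"
  using unit_bound_imp_form_bound[OF lin S _ max] x(2)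
  by (intro symmetric_form_maximizer[OF lin sym S x(1) y]) (auto simp: dot_square_norm)

lemma form_min_orthogonal_residual:
  fixes M :: "'a::real_inner \<Rightarrow> 'a"
  assumes lin: "linear M" and sym: "\<And>x y. inner x (M y) = inner (M x) y"
    and S: "subspace S" and x: "x \<in> S" "norm x = 1" and y: "y \<in> S"
    and min: "\<And>z. z \<in> S \<Longrightarrow> norm z = 1 \<Longrightarrow> inner x (M x) \<le> inner z (M z)"
  shows "inner y (M x - inner x (M x) *\<^sub>R x) = 0"
  using form_max_orthogonal_residual[of "\<lambda>z. - M z" S x y] assms
  by (simp add: linear_compose_neg inner_diff_right)

text \<open>
  For \<open>a \<noteq> b\<close> the hypotheses and symmetry force \<open>inner x y = 0\<close> and \<open>inner x (M y) = 0\<close>. Hence the mixed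
  terms drop out on unit vectors \<open>sqrt (1 - u) x + sqrt u y\<close>, and the form takes the value
  \<open>(1 - u) a + u b\<close> there.
\<close>

lemma symmetric_form_fills_segment:
  fixes M :: "'a::real_inner \<Rightarrow> 'a"
  assumes lin: "linear M" and sym: "\<And>x y. inner x (M y) = inner (M x) y"
    and S: "subspace S" "x \<in> S" "y \<in> S"
    and unit: "norm x = 1" "norm y = 1"
    and x: "\<And>z. z \<in> S \<Longrightarrow> inner z (M x - a *\<^sub>R x) = 0"
    and y: "\<And>z. z \<in> S \<Longrightarrow> inner z (M y - b *\<^sub>R y) = 0"
    and eta: "\<eta> \<in> closed_segment a b"
  shows "\<exists>z\<in>S. norm z = 1 \<and> inner z (M z) = \<eta>"
proof (cases "a = b")
  case True
  then show ?thesis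
    using eta x[OF S(2)] S(2) unit by (auto simp: inner_diff_right dot_square_norm intro!: bexI[of _ x])
next
  case False
  have "inner y (M x) = a * inner x y" "inner x (M y) = b * inner x y"
    using x[OF S(3)] y[OF S(2)] by (simp_all add: inner_diff_right inner_commute)
  with sym[of x y] False have orth: "inner x y = 0"
    by (simp add: inner_commute)
  obtain u where u: "0 \<le> u" "u \<le> 1" "\<eta> = (1 - u) * a + u * b"
    using eta by (auto simp: in_segment)
  let ?z = "sqrt (1 - u) *\<^sub>R x + sqrt u *\<^sub>R y"
  have xx: "inner x x = 1" "inner y y = 1"
    using unit by (simp_all add: dot_square_norm)
  have vals: "inner x (M x) = a" "inner y (M y) = b" "inner x (M y) = 0" "inner y (M x) = 0"
    using x[OF S(2)] y[OF S(3)] x[OF S(3)] y[OF S(2)] orth xx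
    by (simp_all add: inner_diff_right inner_commute)
  have "inner ?z ?z = 1"
    using u orth xx
    by (simp add: inner_add_left inner_add_right inner_commute[of y x] flip: mult.assoc)
  moreover have "inner ?z (M ?z) = \<eta>"
    using u vals
    by (simp add: linear_add[OF lin] linear_scale[OF lin] inner_add_left inner_add_right
        flip: mult.assoc)
  ultimately show ?thesis
    using S by (intro bexI[of _ ?z]) (simp_all add: norm_eq_sqrt_inner subspace_add subspace_scale)
qed

section \<open>The Hermitian product and Hermitian matrices\<close>

lemma Re_cinner: "Re (cinner x y) = inner x y"
  by (simp add: cinner_def inner_vec_def inner_complex_def)

lemma cinner_commute: "cinner y x = cnj (cinner x y)"
  by (simp add: cinner_def mult.commute)

lemma cinner_diff_right: "cinner x (y - z) = cinner x y - cinner x z"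
  by (simp add: cinner_def sum_subtractf algebra_simps)

lemma cinner_scale_right: "cinner x (c *s y) = c * cinner x y"
  by (simp add: cinner_def sum_distrib_left algebra_simps)

lemma cinner_scale_left: "cinner (c *s x) y = cnj c * cinner x y"
  by (simp add: cinner_def sum_distrib_left algebra_simps)

lemma cinner_self: "cinner x x = complex_of_real ((norm x)\<^sup>2)"
proof -
  have "Im (cinner x x) = 0"
    using arg_cong[OF cinner_commute[of x x], of Im] by simp
  then show ?thesis
    by (simp add: complex_eq_iff Re_cinner dot_square_norm)
qed

lemma cinner_self_eq_1: "cinner x x = 1 \<longleftrightarrow> norm x = 1"
  unfolding cinner_self of_real_eq_1_iff power2_eq_1_iff
  using norm_ge_zero[of x] by linarith

lemma cinner_mult_right: "cinner x (B *v y) = cinner (cadjoint B *v x) y"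
proof -
  have "cinner x (B *v y) = (\<Sum>i\<in>UNIV. \<Sum>j\<in>UNIV. cnj (x $ i) * (B $ i $ j * y $ j))"
    by (simp add: cinner_def matrix_vector_mult_def sum_distrib_left)
  also have "\<dots> = (\<Sum>j\<in>UNIV. \<Sum>i\<in>UNIV. cnj (x $ i) * (B $ i $ j * y $ j))"
    by (rule sum.swap)
  also have "\<dots> = cinner (cadjoint B *v x) y"
    by (simp add: cinner_def cadjoint_def matrix_vector_mult_def sum_distrib_left sum_distrib_right mult_ac)
  finally show ?thesis .
qed

lemma scaleR_eq_scale: "r *\<^sub>R x = complex_of_real r *s x" for x :: "complex ^ 'n"
  by (simp add: vec_eq_iff complex_eq_iff)

lemma linear_matrix: "linear ((*v) H)" for H :: "complex ^ 'n ^ 'm"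
  by (rule linearI) (simp_all add: matrix_vector_right_distrib scaleR_eq_scale vector_scalar_commute)

lemma Hermitian_inner_sym:
  assumes "cadjoint H = H"
  shows "inner x (H *v y) = inner (H *v x) y"
  using assms by (simp flip: Re_cinner add: cinner_mult_right)

lemma cinner_Hermitian_real:
  assumes "cadjoint H = H"
  shows "cinner x (H *v x) = complex_of_real (inner x (H *v x))"
proof -
  have "Im (cinner x (H *v x)) = 0"
    using arg_cong[OF cinner_commute[of x "H *v x"], of Im] cinner_mult_right[of x H x] assms
    by simp
  then show ?thesis by (simp add: complex_eq_iff Re_cinner)
qed

lemma cadjoint_mat_Re: "cadjoint (mat_Re B) = mat_Re B"
  by (simp add: cadjoint_def mat_Re_def map_matrix_def vec_eq_iff)

lemma cadjoint_mat_Im: "cadjoint (mat_Im B) = mat_Im B"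
  by (simp add: cadjoint_def mat_Im_def map_matrix_def vec_eq_iff algebra_simps)

lemma num_form_scale: "num_form ((*v) (map_matrix ((*) c) B)) x = c * num_form ((*v) B) x"
  by (simp add: num_form_def cinner_def map_matrix_def matrix_vector_mult_def sum_distrib_left mult_ac)

lemma num_form_cadjoint: "num_form ((*v) (cadjoint B)) x = cnj (num_form ((*v) B) x)"
  unfolding num_form_def by (metis cinner_commute cinner_mult_right)

lemma num_form_add: "num_form ((*v) (B + C)) x = num_form ((*v) B) x + num_form ((*v) C) x"
  by (simp add: num_form_def cinner_def matrix_vector_mult_add_rdistrib sum.distrib algebra_simps)

lemma num_form_diff: "num_form ((*v) (B - C)) x = num_form ((*v) B) x - num_form ((*v) C) x"
  by (simp add: num_form_def cinner_diff_right matrix_vector_mult_diff_rdistrib)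

lemma num_form_mat_Re: "num_form ((*v) (mat_Re B)) x = complex_of_real (Re (num_form ((*v) B) x))"
  by (simp add: mat_Re_def num_form_scale num_form_add num_form_cadjoint complex_add_cnj)

lemma num_form_mat_Im: "num_form ((*v) (mat_Im B)) x = complex_of_real (Im (num_form ((*v) B) x))"
  by (simp add: mat_Im_def num_form_scale num_form_diff num_form_cadjoint complex_diff_cnj complex_eq_iff)

text \<open>
  \<open>f\<^sub>A(x)\<close> and the Hermitian matrices \<open>A(\<theta>)\<close>, \<open>A'(\<theta>)\<close> are tied together by rotating the plane by
  \<open>- \<theta>\<close> and taking real and imaginary parts.
\<close>

lemma num_form_A_of:
  "num_form ((*v) (A_of A \<theta>)) x = complex_of_real (inner (num_form ((*v) A) x) (cis \<theta>))"
  by (simp add: A_of_def num_form_mat_Re num_form_scale inner_complex_def algebra_simps)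

lemma num_form_A'_of:
  "num_form ((*v) (A'_of A \<theta>)) x = complex_of_real (g_map \<theta> (num_form ((*v) A) x))"
  by (simp add: A'_of_def num_form_mat_Im num_form_scale g_map_def inner_complex_def algebra_simps)

lemma inner_A_of: "inner x (A_of A \<theta> *v x) = inner (num_form ((*v) A) x) (cis \<theta>)"
  using arg_cong[OF num_form_A_of[of A \<theta> x], of Re] by (simp add: num_form_def Re_cinner)

lemma inner_A'_of: "inner x (A'_of A \<theta> *v x) = g_map \<theta> (num_form ((*v) A) x)"
  using arg_cong[OF num_form_A'_of[of A \<theta> x], of Re] by (simp add: num_form_def Re_cinner)

lemma continuous_num_form: "continuous_on S (num_form ((*v) B))"
  unfolding num_form_def cinner_def matrix_vector_mult_def
  by (simp, intro continuous_intros)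

section \<open>Extreme eigenvalues of compressions\<close>

lemma vec_subspace_imp_subspace: "vec.subspace X \<Longrightarrow> subspace X" for X :: "(complex ^ 'n) set"
  by (auto simp: vec.subspace_def subspace_def scaleR_eq_scale)

text \<open>
  On complex vectors, \<open>inner\<close> is only the real part of the Hermitian product. On a complex subspace this makes no difference, because the subspace contains
  \<open>\<i> *s u\<close> together with \<open>u\<close>.
\<close>

lemma orthogonal_imp_cinner_eq_0:
  assumes X: "vec.subspace X" and u: "u \<in> X" and orth: "\<And>u. u \<in> X \<Longrightarrow> inner u z = 0"
  shows "cinner u z = 0"
proof -
  have "\<i> *s u \<in> X" using X u by (simp add: vec.subspace_scale)
  then have "Re (cinner (\<i> *s u) z) = 0" "Re (cinner u z) = 0"
    using orth u by (simp_all add: Re_cinner)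
  then show ?thesis by (simp add: cinner_scale_left complex_eq_iff)
qed

lemma orth_proj_eqI:
  assumes X: "vec.subspace X" and w: "w \<in> X" "\<And>u. u \<in> X \<Longrightarrow> cinner u (v - w) = 0"
  shows "orth_proj X v = w"
  unfolding orth_proj_def
proof (rule the_equality)
  fix w' assume w': "w' \<in> X \<and> (\<forall>u\<in>X. cinner u (v - w') = 0)"
  then have "w' - w \<in> X" using X w by (simp add: vec.subspace_diff)
  then have "cinner (w' - w) (v - w) - cinner (w' - w) (v - w') = 0" using w w' by simp
  then have "cinner (w' - w) (w' - w) = 0" by (simp flip: cinner_diff_right)
  then show "w' = w" by (simp add: cinner_self)
qed (use w in simp)

lemma orth_proj_correct:
  assumes X: "vec.subspace X"
  shows "orth_proj X v \<in> X" and "u \<in> X \<Longrightarrow> cinner u (v - orth_proj X v) = 0"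
proof -
  have span: "span X = X" using vec_subspace_imp_subspace[OF X] by simp
  obtain w z where wz: "w \<in> span X" "\<And>u. u \<in> span X \<Longrightarrow> orthogonal z u" "v = w + z"
    using orthogonal_subspace_decomp_exists[of X v] by blast
  have "cinner u (v - w) = 0" if "u \<in> X" for u
    using wz that unfolding span
    by (intro orthogonal_imp_cinner_eq_0[OF X that]) (auto simp: orthogonal_def inner_commute)
  moreover have "orth_proj X v = w"
    using calculation wz span by (intro orth_proj_eqI[OF X]) auto
  ultimately show "orth_proj X v \<in> X" and "u \<in> X \<Longrightarrow> cinner u (v - orth_proj X v) = 0"
    using wz span by auto
qed

lemma compression_apply:
  assumes "vec.subspace X" "x \<in> X"
  shows "compression B X x = orth_proj X (B *v x)"
proof -
  have "orth_proj X x = x" using assms by (intro orth_proj_eqI) (auto simp: cinner_def)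
  then show ?thesis using assms by (simp add: compression_def)
qed

lemma compression_UNIV: "compression B UNIV = (*v) B"
proof
  fix x
  have "orth_proj UNIV (B *v x) = B *v x" by (rule orth_proj_eqI) (auto simp: cinner_def)
  then show "compression B UNIV x = B *v x" by (simp add: compression_apply)
qed

lemma num_form_compression:
  assumes X: "vec.subspace X" and x: "x \<in> X"
  shows "num_form (compression B X) x = num_form ((*v) B) x"
  using orth_proj_correct(2)[OF X x, of "B *v x"]
  by (simp add: num_form_def compression_apply[OF X x] cinner_diff_right)

text \<open>
  Eigenvalues of a compression are Rayleigh quotients of the matrix itself at vectors of \<open>X\<close>, so bounds
  on the form over \<open>X\<close> bound them.
\<close>

lemma eigenvalue_compression_Rayleigh:
  assumes X: "vec.subspace X" and H: "cadjoint H = H"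
    and ev: "eigenvalue_on X (compression H X) \<mu>"
  shows "\<mu> \<in> \<real> \<and> (\<exists>x\<in>X. x \<noteq> 0 \<and> inner x (H *v x) = Re \<mu> * inner x x)"
proof -
  obtain x where x: "x \<in> X" "x \<noteq> 0" "compression H X x = \<mu> *s x"
    using ev by (auto simp: eigenvalue_on_def)
  have "\<mu> * complex_of_real ((norm x)\<^sup>2) = complex_of_real (inner x (H *v x))"
    using num_form_compression[OF X x(1), of H] x(3) cinner_Hermitian_real[OF H, of x]
    by (simp add: num_form_def cinner_scale_right cinner_self)
  then have mu: "\<mu> = complex_of_real (inner x (H *v x) / (norm x)\<^sup>2)"
    using x(2) by (simp add: field_simps)
  show ?thesis
    using x(1,2) by (auto simp: mu dot_square_norm intro!: bexI[of _ x])
qed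

lemma orthogonal_residual_imp_eigenvalue:
  assumes X: "vec.subspace X" and x: "x \<in> X" "norm x = 1"
    and orth: "\<And>y. y \<in> X \<Longrightarrow> inner y (H *v x - r *\<^sub>R x) = 0"
  shows "eigenvalue_on X (compression H X) (complex_of_real r)"
proof -
  have "orth_proj X (H *v x) = complex_of_real r *s x"
    using orthogonal_imp_cinner_eq_0[OF X _ orth] X x
    by (intro orth_proj_eqI) (auto simp: vec.subspace_scale scaleR_eq_scale)
  then show ?thesis
    using x unfolding eigenvalue_on_def by (auto simp: compression_apply[OF X] intro!: bexI[of _ x])
qed

lemma is_max_eigenvalue_compression:
  assumes X: "vec.subspace X" and H: "cadjoint H = H" and x: "x \<in> X" "norm x = 1"
    and max: "\<And>z. z \<in> X \<Longrightarrow> norm z = 1 \<Longrightarrow> inner z (H *v z) \<le> inner x (H *v x)"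
  shows "is_max_eigenvalue_on X (compression H X) (inner x (H *v x))"
  unfolding is_max_eigenvalue_on_def
proof (intro conjI allI impI)
  note S = vec_subspace_imp_subspace[OF X]
  note sym = Hermitian_inner_sym[OF H]
  show "eigenvalue_on X (compression H X) (complex_of_real (inner x (H *v x)))"
    using form_max_orthogonal_residual[OF linear_matrix sym S x _ max]
    by (intro orthogonal_residual_imp_eigenvalue[OF X x]) auto
  fix \<mu> assume "eigenvalue_on X (compression H X) \<mu>"
  from eigenvalue_compression_Rayleigh[OF X H this] obtain z
    where z: "\<mu> \<in> \<real>" "z \<in> X" "z \<noteq> 0" "inner z (H *v z) = Re \<mu> * inner z z" by blast
  then show "\<mu> \<in> \<real>" "Re \<mu> \<le> inner x (H *v x)"
    using unit_bound_imp_form_bound[OF linear_matrix S z(2) max] by auto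
qed

lemma is_min_eigenvalue_compression:
  assumes X: "vec.subspace X" and H: "cadjoint H = H" and x: "x \<in> X" "norm x = 1"
    and min: "\<And>z. z \<in> X \<Longrightarrow> norm z = 1 \<Longrightarrow> inner x (H *v x) \<le> inner z (H *v z)"
  shows "is_min_eigenvalue_on X (compression H X) (inner x (H *v x))"
  unfolding is_min_eigenvalue_on_def
proof (intro conjI allI impI)
  note S = vec_subspace_imp_subspace[OF X]
  note sym = Hermitian_inner_sym[OF H]
  show "eigenvalue_on X (compression H X) (complex_of_real (inner x (H *v x)))"
    using form_min_orthogonal_residual[OF linear_matrix sym S x _ min]
    by (intro orthogonal_residual_imp_eigenvalue[OF X x]) auto
  fix \<mu> assume "eigenvalue_on X (compression H X) \<mu>"
  from eigenvalue_compression_Rayleigh[OF X H this] obtain z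
    where z: "\<mu> \<in> \<real>" "z \<in> X" "z \<noteq> 0" "inner z (H *v z) = Re \<mu> * inner z z" by blast
  then show "\<mu> \<in> \<real>" "inner x (H *v x) \<le> Re \<mu>"
    using unit_bound_imp_form_bound[OF linear_compose_neg[OF linear_matrix] S z(2),
        of H "- inner x (H *v x)"] min by auto
qed

section \<open>The maximal eigenvalue as a support function\<close>

lemma continuous_attains_sup_unit:
  fixes f :: "complex ^ 'n \<Rightarrow> real"
  assumes X: "vec.subspace X" and nz: "v \<in> X" "v \<noteq> 0" and f: "continuous_on UNIV f"
  obtains x where "x \<in> X" "norm x = 1" "\<And>z. z \<in> X \<Longrightarrow> norm z = 1 \<Longrightarrow> f z \<le> f x"
proof -
  note S = vec_subspace_imp_subspace[OF X]
  have "compact (sphere 0 1 \<inter> X)"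
    using closed_subspace[OF S] by (simp add: compact_Int_closed)
  moreover have "(1 / norm v) *\<^sub>R v \<in> sphere 0 1 \<inter> X"
    using S nz by (simp add: subspace_scale)
  ultimately show thesis
    using continuous_attains_sup[of "sphere 0 1 \<inter> X" f] continuous_on_subset[OF f] that by fastforce
qed

text \<open>
  The maximal eigenvalue is defined by a description, which only becomes usable once a maximal
  eigenvalue is known to exist. A maximizer of the form of \<open>A(\<theta>)\<close> on the unit sphere provides it,
  and so \<open>lam_max A\<close> is the support function of the numerical range.
\<close>

lemma lam_max_attained:
  fixes A :: "complex ^ 'n ^ 'n"
  obtains x where "norm x = 1" "inner (num_form ((*v) A) x) (cis \<theta>) = lam_max A \<theta>"
    "\<And>z. norm z = 1 \<Longrightarrow> inner (num_form ((*v) A) z) (cis \<theta>) \<le> lam_max A \<theta>"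
proof -
  have cont: "continuous_on UNIV (\<lambda>x. inner (num_form ((*v) A) x) (cis \<theta>))"
    by (intro continuous_intros continuous_num_form)
  obtain x where x: "norm x = 1"
    "\<And>z. norm z = 1 \<Longrightarrow> inner (num_form ((*v) A) z) (cis \<theta>) \<le> inner (num_form ((*v) A) x) (cis \<theta>)"
    using continuous_attains_sup_unit[OF vec.subspace_UNIV UNIV_I one_neq_zero cont] by auto
  let ?H = "A_of A \<theta>"
  have "is_max_eigenvalue_on UNIV (compression ?H UNIV) (inner x (?H *v x))"
    using x by (intro is_max_eigenvalue_compression) (auto simp: A_of_def cadjoint_mat_Re inner_A_of[unfolded A_of_def])
  then have "lam_max A \<theta> = inner x (?H *v x)"
    unfolding lam_max_def compression_UNIV
    by (intro the_equality) (auto simp: is_max_eigenvalue_on_def intro!: antisym)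
  then show thesis using that x by (simp add: inner_A_of)
qed

lemma subspace_X_max: "vec.subspace (X_max A \<theta>)"
  by (auto simp: vec.subspace_def X_max_def matrix_vector_right_distrib vector_scalar_commute
      vec.scale_left_commute)

text \<open>
  Unit vectors that attain the maximum are eigenvectors: for the whole space, the residual of
  \<open>form_max_orthogonal_residual\<close> is orthogonal to everything.
\<close>

lemma X_max_iff:
  assumes "norm x = 1"
  shows "x \<in> X_max A \<theta> \<longleftrightarrow> inner (num_form ((*v) A) x) (cis \<theta>) = lam_max A \<theta>"
proof
  assume "x \<in> X_max A \<theta>"
  then show "inner (num_form ((*v) A) x) (cis \<theta>) = lam_max A \<theta>"
    using assms by (simp flip: inner_A_of add: X_max_def flip: scaleR_eq_scale add: dot_square_norm)
next
  assume eq: "inner (num_form ((*v) A) x) (cis \<theta>) = lam_max A \<theta>"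
  let ?M = "(*v) (A_of A \<theta>)"
  have "cadjoint (A_of A \<theta>) = A_of A \<theta>" by (simp add: A_of_def cadjoint_mat_Re)
  note sym = Hermitian_inner_sym[OF this]
  have "inner z (?M z) \<le> inner x (?M x)" if "norm z = 1" for z
    using lam_max_attained[of A \<theta>] that eq unfolding inner_A_of by metis
  then have "inner y (?M x - inner x (?M x) *\<^sub>R x) = 0" for y
    using form_max_orthogonal_residual[OF linear_matrix sym subspace_UNIV, of x y] assms by simp
  then have "?M x - inner x (?M x) *\<^sub>R x = 0"
    using inner_eq_zero_iff by blast
  then show "x \<in> X_max A \<theta>"
    using eq by (simp add: X_max_def inner_A_of scaleR_eq_scale)
qed

lemma exposed_face_eq:
  "exposed_face A \<theta> = num_form ((*v) A) ` {x \<in> X_max A \<theta>. norm x = 1}"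
proof -
  obtain x0 where x0: "norm x0 = 1" "inner (num_form ((*v) A) x0) (cis \<theta>) = lam_max A \<theta>"
    and ub: "\<And>z. norm z = 1 \<Longrightarrow> inner (num_form ((*v) A) z) (cis \<theta>) \<le> lam_max A \<theta>"
    using lam_max_attained[of A \<theta>] by blast
  show ?thesis
  proof (intro equalityI subsetI)
    fix \<alpha> assume "\<alpha> \<in> exposed_face A \<theta>"
    then obtain x where x: "norm x = 1" "\<alpha> = num_form ((*v) A) x"
      and "\<not> inner (num_form ((*v) A) x0) (cis \<theta>) > inner \<alpha> (cis \<theta>)"
      using x0(1) by (auto simp: exposed_face_def is_arg_max_def numerical_range_def cinner_self_eq_1)
    then have "inner \<alpha> (cis \<theta>) = lam_max A \<theta>" using ub[of x] x0 by simp
    then show "\<alpha> \<in> num_form ((*v) A) ` {x \<in> X_max A \<theta>. norm x = 1}"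
      using x by (auto simp: X_max_iff)
  next
    fix \<alpha> assume "\<alpha> \<in> num_form ((*v) A) ` {x \<in> X_max A \<theta>. norm x = 1}"
    then show "\<alpha> \<in> exposed_face A \<theta>"
      using ub by (fastforce simp: exposed_face_def is_arg_max_def numerical_range_def cinner_self_eq_1 X_max_iff not_less)
  qed
qed

lemma compact_numerical_range: "compact (numerical_range A)"
proof -
  have "numerical_range A = num_form ((*v) A) ` sphere 0 1"
    by (auto simp: numerical_range_def cinner_self_eq_1)
  then show ?thesis
    by (simp add: compact_continuous_image continuous_num_form)
qed

section \<open>One-sided derivatives of a support function\<close>

lemma cis_difference_quotient:
  "((\<lambda>t. (cis (\<theta> + t * v) - cis \<theta>) /\<^sub>R t) \<longlongrightarrow> v *\<^sub>R (\<i> * cis \<theta>)) (at_right 0)"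
proof -
  have "((\<lambda>t. cis (\<theta> + t * v)) has_vector_derivative v *\<^sub>R (\<i> * cis \<theta>)) (at_right 0)"
    unfolding has_vector_derivative_def
    by (rule derivative_eq_intros refl | simp)+
  then show ?thesis
    by (simp add: has_vector_derivative_complex_iff has_field_derivative_iff tendsto_complex_iff
        divide_inverse mult.commute)
qed

text \<open>
  The difference quotient is bounded below by the one of \<open>\<alpha>0\<close>, which stays a competitor at
  \<open>\<theta> + t * v\<close>, and above by the one of any point \<open>\<alpha>\<close> that attains \<open>h (\<theta> + t * v)\<close>, which is a
  competitor at \<open>\<theta>\<close>. For the upper bound, \<open>\<alpha>\<close> has to have an almost admissible slope: the points of
  \<open>K\<close> with slope at least \<open>\<epsilon>\<close> above the optimum form a compact set that misses the face at
  \<open>\<theta>\<close>, so they stay below \<open>h \<theta>\<close> by a uniform gap \<open>\<delta>\<close> and cannot win for small \<open>t\<close>.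
\<close>

lemma support_function_directional_derivative:
  fixes K :: "complex set" and h :: "real \<Rightarrow> real"
  assumes K: "compact K"
    and att: "\<And>s. \<exists>\<alpha>\<in>K. inner \<alpha> (cis s) = h s"
    and ub: "\<And>s \<alpha>. \<alpha> \<in> K \<Longrightarrow> inner \<alpha> (cis s) \<le> h s"
    and \<alpha>0: "\<alpha>0 \<in> K" "inner \<alpha>0 (cis \<theta>) = h \<theta>"
    and max: "\<And>\<alpha>. \<alpha> \<in> K \<Longrightarrow> inner \<alpha> (cis \<theta>) = h \<theta> \<Longrightarrow> v * g_map \<theta> \<alpha> \<le> v * g_map \<theta> \<alpha>0"
  shows "((\<lambda>t. (h (\<theta> + t * v) - h \<theta>) / t) \<longlongrightarrow> v * g_map \<theta> \<alpha>0) (at_right 0)"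
proof (rule order_tendstoI)
  define D where "D t = (cis (\<theta> + t * v) - cis \<theta>) /\<^sub>R t" for t
  have g: "inner \<alpha> (v *\<^sub>R (\<i> * cis \<theta>)) = v * g_map \<theta> \<alpha>" for \<alpha>
    by (simp add: g_map_def)
  have D: "(D \<longlongrightarrow> v *\<^sub>R (\<i> * cis \<theta>)) (at_right 0)"
    unfolding D_def by (rule cis_difference_quotient)
  have innerD: "inner \<alpha> (D t) = (inner \<alpha> (cis (\<theta> + t * v)) - inner \<alpha> (cis \<theta>)) / t" for \<alpha> t
    by (simp add: D_def inner_diff_right divide_inverse mult.commute)
  have pos: "eventually (\<lambda>t::real. t > 0) (at_right 0)"
    by (simp add: eventually_at_right_less)
  {
    fix l assume "l < v * g_map \<theta> \<alpha>0"
    moreover have "((\<lambda>t. inner \<alpha>0 (D t)) \<longlongrightarrow> v * g_map \<theta> \<alpha>0) (at_right 0)"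
      using tendsto_inner[OF tendsto_const D] unfolding g .
    ultimately have "eventually (\<lambda>t. l < inner \<alpha>0 (D t)) (at_right 0)"
      by (simp add: order_tendstoD)
    then show "eventually (\<lambda>t. l < (h (\<theta> + t * v) - h \<theta>) / t) (at_right 0)"
      using pos
    proof eventually_elim
      case (elim t)
      have "inner \<alpha>0 (D t) \<le> (h (\<theta> + t * v) - h \<theta>) / t"
        unfolding innerD using ub[OF \<alpha>0(1), of "\<theta> + t * v"] \<alpha>0(2) elim
        by (intro divide_right_mono) auto
      then show ?case using elim by simp
    qed
  }
  fix l assume l: "v * g_map \<theta> \<alpha>0 < l"
  define \<epsilon> where "\<epsilon> = (l - v * g_map \<theta> \<alpha>0) / 2"
  have \<epsilon>: "\<epsilon> > 0" "v * g_map \<theta> \<alpha>0 + 2 * \<epsilon> = l"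
    using l by (simp_all add: \<epsilon>_def field_simps)
  obtain B where B: "B > 0" "\<And>\<alpha>. \<alpha> \<in> K \<Longrightarrow> norm \<alpha> \<le> B"
    using compact_imp_bounded[OF K] by (auto simp: bounded_pos)
  \<comment> \<open>The points whose slope is too large to be a maximizer at a nearby angle.\<close>
  define K' where "K' = K \<inter> {\<alpha>. v * g_map \<theta> \<alpha> \<ge> v * g_map \<theta> \<alpha>0 + \<epsilon>}"
  have "compact K'" unfolding K'_def g_map_def
    by (intro compact_Int_closed K closed_Collect_le continuous_intros)
  have "\<exists>\<delta>>0. \<forall>\<alpha>\<in>K'. inner \<alpha> (cis \<theta>) \<le> h \<theta> - \<delta>"
  proof (cases "K' = {}")
    case False
    obtain \<beta> where \<beta>: "\<beta> \<in> K'" "\<And>\<alpha>. \<alpha> \<in> K' \<Longrightarrow> inner \<alpha> (cis \<theta>) \<le> inner \<beta> (cis \<theta>)"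
      using continuous_attains_sup[OF \<open>compact K'\<close> False, of "\<lambda>\<alpha>. inner \<alpha> (cis \<theta>)"]
        continuous_on_inner[OF continuous_on_id continuous_on_const, of K' "cis \<theta>"] by auto
    then have "inner \<beta> (cis \<theta>) < h \<theta>"
      using max[of \<beta>] ub[of \<beta> \<theta>] \<epsilon> unfolding K'_def by force
    then show ?thesis using \<beta> by (intro exI[of _ "h \<theta> - inner \<beta> (cis \<theta>)"]) auto
  qed (auto intro: exI[of _ 1])
  then obtain \<delta> where \<delta>: "\<delta> > 0" "\<And>\<alpha>. \<alpha> \<in> K' \<Longrightarrow> inner \<alpha> (cis \<theta>) \<le> h \<theta> - \<delta>" by blast
  \<comment> \<open>Uniformity in the point of \<open>K\<close>: changing the direction moves all coordinates by little at once.\<close>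
  have close: "\<bar>inner \<alpha> z\<bar> \<le> B * norm z" if "\<alpha> \<in> K" for \<alpha> z
    using Cauchy_Schwarz_ineq2[of \<alpha> z] B(2)[OF that] by (smt (verit) mult_right_mono norm_ge_zero)
  have "((\<lambda>t. B * norm (cis (\<theta> + t * v) - cis \<theta>)) \<longlongrightarrow> B * norm (cis (\<theta> + 0 * v) - cis \<theta>)) (at_right 0)"
    unfolding cis_conv_exp by (intro tendsto_intros)
  then have ev1: "eventually (\<lambda>t. B * norm (cis (\<theta> + t * v) - cis \<theta>) < \<delta> / 2) (at_right 0)"
    using \<delta> by (intro order_tendstoD) auto
  have "((\<lambda>t. B * norm (D t - v *\<^sub>R (\<i> * cis \<theta>))) \<longlongrightarrow> B * norm (v *\<^sub>R (\<i> * cis \<theta>) - v *\<^sub>R (\<i> * cis \<theta>))) (at_right 0)"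
    by (intro tendsto_intros D)
  then have ev2: "eventually (\<lambda>t. B * norm (D t - v *\<^sub>R (\<i> * cis \<theta>)) < \<epsilon>) (at_right 0)"
    using \<epsilon> by (intro order_tendstoD) auto
  show "eventually (\<lambda>t. (h (\<theta> + t * v) - h \<theta>) / t < l) (at_right 0)"
    using ev1 ev2 pos
  proof eventually_elim
    case (elim t)
    obtain \<alpha> where \<alpha>: "\<alpha> \<in> K" "inner \<alpha> (cis (\<theta> + t * v)) = h (\<theta> + t * v)" using att by blast
    have "\<alpha> \<notin> K'"
    proof
      assume "\<alpha> \<in> K'"
      then have "inner \<alpha> (cis \<theta>) \<le> h \<theta> - \<delta>" by (rule \<delta>)
      moreover have "inner \<alpha> (cis (\<theta> + t * v)) - inner \<alpha> (cis \<theta>) < \<delta> / 2"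
        using close[OF \<alpha>(1), of "cis (\<theta> + t * v) - cis \<theta>"] elim(1) by (simp add: inner_diff_right)
      moreover have "inner \<alpha>0 (cis (\<theta> + t * v)) - inner \<alpha>0 (cis \<theta>) > - \<delta> / 2"
        using close[OF \<alpha>0(1), of "cis (\<theta> + t * v) - cis \<theta>"] elim(1) by (simp add: inner_diff_right)
      ultimately show False using ub[OF \<alpha>0(1), of "\<theta> + t * v"] \<alpha>(2) \<alpha>0(2) by linarith
    qed
    then have "v * g_map \<theta> \<alpha> < v * g_map \<theta> \<alpha>0 + \<epsilon>" using \<alpha>(1) by (simp add: K'_def)
    moreover have "inner \<alpha> (D t) - v * g_map \<theta> \<alpha> < \<epsilon>"
      using close[OF \<alpha>(1), of "D t - v *\<^sub>R (\<i> * cis \<theta>)"] elim(2) g[of \<alpha>]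
      unfolding inner_diff_right by linarith
    moreover have "(h (\<theta> + t * v) - h \<theta>) / t \<le> inner \<alpha> (D t)"
      unfolding innerD using ub[OF \<alpha>(1), of \<theta>] \<alpha>(2) elim(3) by (intro divide_right_mono) auto
    ultimately show ?case using \<epsilon>(2) by linarith
  qed
qed

lemma dir_deriv_lam_max:
  assumes x: "x \<in> X_max A \<theta>" "norm x = 1"
    and max: "\<And>z. z \<in> X_max A \<theta> \<Longrightarrow> norm z = 1 \<Longrightarrow>
      v * g_map \<theta> (num_form ((*v) A) z) \<le> v * g_map \<theta> (num_form ((*v) A) x)"
  shows "dir_deriv (lam_max A) \<theta> v = v * g_map \<theta> (num_form ((*v) A) x)"
  unfolding dir_deriv_def
proof (rule tendsto_Lim)
  show "((\<lambda>t. (lam_max A (\<theta> + t * v) - lam_max A \<theta>) / t)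
      \<longlongrightarrow> v * g_map \<theta> (num_form ((*v) A) x)) (at_right 0)"
  proof (rule support_function_directional_derivative[OF compact_numerical_range[of A]])
    fix s
    obtain y where "norm y = 1" "inner (num_form ((*v) A) y) (cis s) = lam_max A s"
      using lam_max_attained[of A s] by blast
    then show "\<exists>\<alpha>\<in>numerical_range A. inner \<alpha> (cis s) = lam_max A s"
      by (auto simp: numerical_range_def cinner_self_eq_1)
  next
    fix s \<alpha> assume "\<alpha> \<in> numerical_range A"
    then show "inner \<alpha> (cis s) \<le> lam_max A s"
      using lam_max_attained[of A s]
      by (auto simp: numerical_range_def cinner_self_eq_1)
  qed (use x max X_max_iff in \<open>auto simp: numerical_range_def cinner_self_eq_1\<close>)
qed simp

section \<open>Exposed faces in tangential coordinates\<close>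

lemma h_map_g_map:
  assumes "inner \<alpha> (cis \<theta>) = lam_max A \<theta>"
  shows "h_map A \<theta> (g_map \<theta> \<alpha>) = \<alpha>"
proof -
  have "complex_of_real (inner \<alpha> (cis \<theta>)) + \<i> * complex_of_real (g_map \<theta> \<alpha>) = \<alpha> * cis (- \<theta>)"
    by (simp add: g_map_def inner_complex_def complex_eq_iff)
  then show ?thesis
    unfolding h_map_def assms[symmetric] by (simp add: cis_mult mult.left_commute)
qed

theorem theorem2p3:
  fixes A :: "complex ^ 'n ^ 'n" and \<theta> :: real
  shows "let X = X_max A \<theta>;
             C = compression (A'_of A \<theta>) X;
             F = exposed_face A \<theta>;
             a = dir_deriv (lam_max A) \<theta> 1;
             b = - dir_deriv (lam_max A) \<theta> (-1)
         in (is_max_eigenvalue_on X C a \<and> is_min_eigenvalue_on X C b) \<and>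
            (\<forall>x\<in>X. cinner x x = 1 \<longrightarrow>
               num_form C x = complex_of_real (g_map \<theta> (num_form ((*v) A) x))) \<and>
            (bij_betw (g_map \<theta>) F (closed_segment a b) \<and>
             (\<forall>\<eta>\<in>closed_segment a b. inv_into F (g_map \<theta>) \<eta> = h_map A \<theta> \<eta>))"
proof -
  define X where "X = X_max A \<theta>"
  define C where "C = compression (A'_of A \<theta>) X"
  define F where "F = exposed_face A \<theta>"
  define a where "a = dir_deriv (lam_max A) \<theta> 1"
  define b where "b = - dir_deriv (lam_max A) \<theta> (-1)"
  define q where "q x = g_map \<theta> (num_form ((*v) A) x)" for x
  let ?M = "(*v) (A'_of A \<theta>)"
  have q: "inner x (?M x) = q x" for x
    by (simp add: q_def inner_A'_of)
  have X: "vec.subspace X" unfolding X_def by (rule subspace_X_max)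
  have H: "cadjoint (A'_of A \<theta>) = A'_of A \<theta>" by (simp add: A'_of_def cadjoint_mat_Im)
  note sym = Hermitian_inner_sym[OF H] and S = vec_subspace_imp_subspace[OF X]
  obtain x0 where x0: "norm x0 = 1" "x0 \<in> X"
    using lam_max_attained[of A \<theta>] X_max_iff unfolding X_def by metis
  then have "x0 \<noteq> 0" by auto
  have cont: "continuous_on UNIV q"
    unfolding q_def g_map_def by (intro continuous_intros continuous_num_form)
  obtain x1 where x1: "x1 \<in> X" "norm x1 = 1" "\<And>z. z \<in> X \<Longrightarrow> norm z = 1 \<Longrightarrow> q z \<le> q x1"
    using continuous_attains_sup_unit[OF X x0(2) \<open>x0 \<noteq> 0\<close> cont] by blast
  obtain x2 where x2: "x2 \<in> X" "norm x2 = 1" "\<And>z. z \<in> X \<Longrightarrow> norm z = 1 \<Longrightarrow> q x2 \<le> q z"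
    using continuous_attains_sup_unit[OF X x0(2) \<open>x0 \<noteq> 0\<close> continuous_on_minus[OF cont]] by auto
  have a: "a = q x1"
    using dir_deriv_lam_max[of x1 A \<theta> 1] x1 by (simp add: a_def q_def X_def)
  have b: "b = q x2"
    using dir_deriv_lam_max[of x2 A \<theta> "-1"] x2 by (simp add: b_def q_def X_def)
  have eig: "is_max_eigenvalue_on X C a" "is_min_eigenvalue_on X C b"
    using is_max_eigenvalue_compression[OF X H x1(1,2)] is_min_eigenvalue_compression[OF X H x2(1,2)]
      x1(3) x2(3) by (simp_all add: a b C_def q)
  have form: "num_form C x = complex_of_real (g_map \<theta> (num_form ((*v) A) x))" if "x \<in> X" for x
    using num_form_compression[OF X that] by (simp add: C_def num_form_A'_of)
  have F: "F = num_form ((*v) A) ` {x \<in> X. norm x = 1}"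
    by (simp add: F_def X_def exposed_face_eq)
  have inverse: "h_map A \<theta> (g_map \<theta> \<alpha>) = \<alpha>" if "\<alpha> \<in> F" for \<alpha>
    using that by (auto simp: F X_def X_max_iff h_map_g_map)
  have inj: "inj_on (g_map \<theta>) F" using inverse by (rule inj_on_inverseI)
  have "g_map \<theta> ` F = q ` {x \<in> X. norm x = 1}" by (auto simp: F q_def)
  also have "\<dots> = closed_segment a b"
  proof (intro equalityI subsetI)
    fix \<eta> assume "\<eta> \<in> q ` {x \<in> X. norm x = 1}"
    then have "b \<le> \<eta>" "\<eta> \<le> a" using x1(3) x2(3) by (auto simp: a b)
    then show "\<eta> \<in> closed_segment a b" by (auto simp: closed_segment_eq_real_ivl)
  next
    fix \<eta> assume "\<eta> \<in> closed_segment a b"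
    then have "\<exists>z\<in>X. norm z = 1 \<and> inner z (?M z) = \<eta>"
      using form_max_orthogonal_residual[OF linear_matrix sym S x1(1,2)]
        form_min_orthogonal_residual[OF linear_matrix sym S x2(1,2)] x1(3) x2(3)
      by (intro symmetric_form_fills_segment[OF linear_matrix sym S x1(1) x2(1) x1(2) x2(2)])
        (auto simp: a b q)
    then show "\<eta> \<in> q ` {x \<in> X. norm x = 1}" by (auto simp: q)
  qed
  finally have image: "g_map \<theta> ` F = closed_segment a b" .
  have "inv_into F (g_map \<theta>) \<eta> = h_map A \<theta> \<eta>" if "\<eta> \<in> closed_segment a b" for \<eta>
    using that inverse inj by (auto simp flip: image)
  then show ?thesis
    using eig form inj image
    unfolding Let_def bij_betw_def X_def C_def F_def a_def b_def by blast
qed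

end
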